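(* Let $\mathcal{L}$ be a finite distributive lattice. Then $$\sum_{i\ge 0}(-1)^{i}\,b_i(\mathcal{L})=1.$$
   Context: The Boolean lattice of rank $i$ is the lattice of all subsets of $\{1,\dots,i\}$ ordered by inclusion. For $I\le J$ in a finite distributive lattice $\mathcal{L}$, the interval $[I,J]$ is $\{M\in\mathcal{L}: I\le M\le J\}$ with the induced order; $b_i(\mathcal{L})$ is the number of intervals of $\mathcal{L}$ that are isomorphic to the Boolean lattice of rank $i$ (so $b_0(\mathcal{L})=|\mathcal{L}|$). Lattices are nonempty. *)

theory Defs
  imports Complex_Main
begin

definition order_isomorphic :: "'a::order set \<Rightarrow> 'b::order set \<Rightarrow> bool" where
  "order_isomorphic A B \<longleftrightarrow>
     (\<exists>f. bij_betw f A B \<and> (\<forall>x\<in>A. \<forall>y\<in>A. x \<le> y \<longleftrightarrow> f x \<le> f y))"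

definition boolean_lattice :: "nat \<Rightarrow> nat set set" where
  "boolean_lattice i = Pow {1..i}"

text \<open>
  The lattice is the whole type \<open>'a\<close>. Distinct pairs \<open>I \<le> J\<close> give distinct sets \<open>{I..J}\<close>,
  so intervals may be counted as sets.
\<close>

definition boolean_intervals :: "nat \<Rightarrow> 'a::order set set" where
  "boolean_intervals i =
     {{I..J} | I J. I \<le> J \<and> order_isomorphic {I..J} (boolean_lattice i)}"

definition num_boolean_intervals :: "'a::order itself \<Rightarrow> nat \<Rightarrow> nat" where
  "num_boolean_intervals _ i = card (boolean_intervals i :: 'a set set)"

end

theory Submission
  imports Defs
begin

text \<open>
  Fix the top \<open>J\<close> of an interval, and let \<open>C\<close> be its set of lower covers. By distributivity
  \<open>S \<mapsto> J \<sqinter> \<Sqinter>S\<close> is an order embedding of the subsets of \<open>C\<close>, ordered by reverse inclusion,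
  and the Boolean intervals of rank \<open>i\<close> with top \<open>J\<close> are exactly those whose bottom is the meet
  of an \<open>i\<close>-subset of \<open>C\<close>. So \<open>J\<close> contributes the alternating sum of the binomial coefficients
  of \<open>card C\<close>, which vanishes unless \<open>J\<close> is the least element.
\<close>

definition lower_covers :: "'a::order \<Rightarrow> 'a set" where
  "lower_covers J = {c. c < J \<and> (\<forall>x. c \<le> x \<longrightarrow> x \<le> J \<longrightarrow> x = c \<or> x = J)}"

text \<open>Inserting \<open>J\<close> keeps the argument of \<open>Inf_fin\<close> nonempty and
  makes \<open>J\<close> the meet of the empty set, which covers the intervals of rank 0.\<close>

definition meet_below :: "'a::lattice \<Rightarrow> 'a set \<Rightarrow> 'a" where
  "meet_below J S = Inf_fin (insert J S)"

lemma lower_coversD: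
  assumes "c \<in> lower_covers J"
  shows "c < J" "c \<le> x \<Longrightarrow> x \<le> J \<Longrightarrow> x = c \<or> x = J"
  using assms by (auto simp: lower_covers_def)

lemma le_meet_below_iff:
  "finite S \<Longrightarrow> x \<le> meet_below J S \<longleftrightarrow> x \<le> J \<and> (\<forall>s\<in>S. x \<le> s)"
  by (simp add: meet_below_def Inf_fin.bounded_iff)

lemma meet_below_le:
  assumes "finite S"
  shows "meet_below J S \<le> J" "s \<in> S \<Longrightarrow> meet_below J S \<le> s"
  using le_meet_below_iff[OF assms, of "meet_below J S" J] by auto

text \<open>Distributivity enters here: \<open>sup x\<close> commutes with finite meets, so a lower
  bound can be checked on each member separately.\<close>

lemma sup_meet_below_le:
  fixes J :: "'a::distrib_lattice"
  assumes "finite S" "y \<le> sup x J" "\<And>s. s \<in> S \<Longrightarrow> y \<le> sup x s"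
  shows "y \<le> sup x (meet_below J S)"
proof -
  have "sup x (meet_below J S) = Inf_fin {sup x a | a. a \<in> insert J S}"
    unfolding meet_below_def using assms(1) by (intro sup_Inf1_distrib) auto
  moreover have "{sup x a | a. a \<in> insert J S} = sup x ` insert J S"
    by auto
  ultimately show ?thesis
    using assms by (auto simp: Inf_fin.bounded_iff)
qed

text \<open>If \<open>c\<close> is outside \<open>S\<close>, its join with each member of
  \<open>S\<close> is \<open>J\<close>; by distributivity so is its join with the meet, which
  therefore cannot lie below \<open>c\<close>.\<close>

lemma meet_below_le_lower_cover_iff:
  fixes J :: "'a::distrib_lattice"
  assumes S: "finite S" "S \<subseteq> lower_covers J" and c: "c \<in> lower_covers J"
  shows "meet_below J S \<le> c \<longleftrightarrow> c \<in> S"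
proof
  assume le: "meet_below J S \<le> c"
  show "c \<in> S"
  proof (rule ccontr)
    assume "c \<notin> S"
    have "J \<le> sup c s" if "s \<in> S" for s
    proof -
      have s: "s \<in> lower_covers J" "s \<noteq> c"
        using that S \<open>c \<notin> S\<close> by auto
      have "sup c s \<le> J"
        using lower_coversD(1)[OF c] lower_coversD(1)[OF s(1)] by (simp add: less_imp_le)
      \<comment> \<open>The join lies above both covers, so if it were not \<open>J\<close> it would
        equal both \<open>c\<close> and \<open>s\<close>.\<close>
      then show ?thesis
        using lower_coversD(2)[OF c, of "sup c s"] lower_coversD(2)[OF s(1), of "sup c s"] s(2)
        by auto
    qed
    then have "J \<le> sup c (meet_below J S)"
      by (intro sup_meet_below_le S) auto
    also have "\<dots> = c"
      using le by (simp add: sup_absorb1)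
    finally show False
      using lower_coversD(1)[OF c] by auto
  qed
qed (rule meet_below_le(2)[OF S(1)])

lemma meet_below_mono_iff:
  fixes J :: "'a::distrib_lattice"
  assumes "finite S" "S \<subseteq> lower_covers J" "finite T" "T \<subseteq> lower_covers J"
  shows "meet_below J S \<le> meet_below J T \<longleftrightarrow> T \<subseteq> S"
  using assms meet_below_le_lower_cover_iff[OF assms(1,2)]
  by (auto simp: le_meet_below_iff meet_below_le)

text \<open>Each \<open>x\<close> in the interval is the meet of \<open>J\<close> and the members of
  \<open>S\<close> above \<open>x\<close>: every other member joins with \<open>x\<close> to
  \<open>J\<close>, so distributivity bounds this meet by \<open>sup x (meet_below J S)\<close>,
  which is \<open>x\<close>.\<close>

lemma interval_meet_below_eq:
  fixes J :: "'a::distrib_lattice"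
  assumes S: "finite S" "S \<subseteq> lower_covers J"
  shows "{meet_below J S..J} = meet_below J ` Pow S"
proof (intro equalityI subsetI)
  fix x assume "x \<in> {meet_below J S..J}"
  then have x: "meet_below J S \<le> x" "x \<le> J" by auto
  let ?T = "{s \<in> S. x \<le> s}"
  have fin: "finite ?T" using S by auto
  have "meet_below J ?T \<le> sup x s" if "s \<in> S" for s
  proof (cases "x \<le> s")
    case True
    then show ?thesis
      using that meet_below_le(2)[OF fin, of s] by (simp add: le_supI2)
  next
    case False
    have s: "s \<in> lower_covers J" using that S by auto
    have "sup x s = J"
      using lower_coversD(2)[OF s, of "sup x s"] lower_coversD(1)[OF s] x(2) False
      by (metis less_imp_le sup.bounded_iff sup_ge1 sup_ge2)
    then show ?thesis
      using meet_below_le(1)[OF fin] by simp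
  qed
  then have "meet_below J ?T \<le> sup x (meet_below J S)"
    using meet_below_le(1)[OF fin] by (intro sup_meet_below_le S) (auto simp: le_supI2)
  also have "\<dots> = x" using x by (simp add: sup_absorb1)
  finally have "x = meet_below J ?T"
    using x fin by (intro antisym) (auto simp: le_meet_below_iff)
  then show "x \<in> meet_below J ` Pow S" by blast
next
  fix x assume "x \<in> meet_below J ` Pow S"
  then obtain T where T: "T \<subseteq> S" "x = meet_below J T" by auto
  then show "x \<in> {meet_below J S..J}"
    using S finite_subset[OF T(1) S(1)] meet_below_mono_iff[of S J T]
    by (auto simp: meet_below_le)
qed

lemma order_isomorphic_interval_meet_below:
  fixes J :: "'a::distrib_lattice"
  assumes S: "finite S" "S \<subseteq> lower_covers J"
  shows "order_isomorphic {meet_below J S..J} (boolean_lattice (card S))"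
proof -
  obtain h where h: "bij_betw h S {1..card S}"
    using S(1) by (metis card_atLeastAtMost diff_Suc_1 finite_atLeastAtMost
        finite_same_card_bij)
  have mono: "meet_below J T \<le> meet_below J T' \<longleftrightarrow> T' \<subseteq> T" if "T \<subseteq> S" "T' \<subseteq> S" for T T'
    using that S by (intro meet_below_mono_iff) (auto intro: finite_subset)
  have "inj_on (meet_below J) (Pow S)"
    by (intro inj_onI) (metis PowD mono order.refl subset_antisym)
  then have bij1: "bij_betw (meet_below J) (Pow S) {meet_below J S..J}"
    by (simp add: bij_betw_def interval_meet_below_eq[OF S])
  define u where "u = inv_into (Pow S) (meet_below J)"
  have u: "u x \<subseteq> S" "meet_below J (u x) = x" if "x \<in> {meet_below J S..J}" for x
    using that bij_betw_inv_into_right[OF bij1] bij_betwE[OF bij_betw_inv_into[OF bij1]]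
    by (auto simp: u_def)
  \<comment> \<open>\<open>meet_below J\<close> reverses inclusion; complementation in
    \<open>S\<close> reverses it back, and \<open>h\<close> then relabels \<open>S\<close> as
    \<open>{1..card S}\<close>.\<close>
  have bij2: "bij_betw (\<lambda>T. S - T) (Pow S) (Pow S)"
    by (rule bij_betw_byWitness[where f' = "\<lambda>T. S - T"]) auto
  have bij: "bij_betw ((\<lambda>T. h ` T) \<circ> ((\<lambda>T. S - T) \<circ> u)) {meet_below J S..J}
      (boolean_lattice (card S))"
    unfolding boolean_lattice_def u_def
    by (intro bij_betw_trans[OF bij_betw_trans[OF bij_betw_inv_into[OF bij1] bij2]]
        bij_betw_Pow h)
  have "x \<le> y \<longleftrightarrow> h ` (S - u x) \<subseteq> h ` (S - u y)"
    if x: "x \<in> {meet_below J S..J}" and y: "y \<in> {meet_below J S..J}" for x y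
  proof -
    have "x \<le> y \<longleftrightarrow> u y \<subseteq> u x"
      using mono[OF u(1)[OF x] u(1)[OF y]] u(2)[OF x] u(2)[OF y] by simp
    also have "\<dots> \<longleftrightarrow> S - u x \<subseteq> S - u y"
      using u(1)[OF x] u(1)[OF y] by blast
    also have "\<dots> \<longleftrightarrow> h ` (S - u x) \<subseteq> h ` (S - u y)"
      using bij_betw_imp_inj_on[OF h] unfolding inj_on_def by blast
    finally show ?thesis .
  qed
  then show ?thesis
    unfolding order_isomorphic_def using bij
    by (intro exI[of _ "(\<lambda>T. h ` T) \<circ> ((\<lambda>T. S - T) \<circ> u)"]) auto
qed

text \<open>The isomorphism matches the coatoms of the Boolean lattice with lower covers of
  \<open>J\<close>. The coatoms intersect in the empty set, so these covers meet in
  \<open>I\<close>.\<close>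

lemma boolean_interval_bottom:
  fixes I J :: "'a::lattice"
  assumes "I \<le> J" and iso: "order_isomorphic {I..J} (boolean_lattice i)"
  obtains S where "S \<subseteq> lower_covers J" "finite S" "card S = i" "I = meet_below J S"
proof -
  obtain f where bij: "bij_betw f {I..J} (Pow {1..i})"
    and mono: "\<And>x y. x \<in> {I..J} \<Longrightarrow> y \<in> {I..J} \<Longrightarrow> x \<le> y \<longleftrightarrow> f x \<subseteq> f y"
    using iso unfolding order_isomorphic_def boolean_lattice_def by blast
  define g where "g = inv_into {I..J} f"
  have g: "g A \<in> {I..J}" "f (g A) = A" if "A \<subseteq> {1..i}" for A
    using that bij_betw_inv_into_right[OF bij] bij_betwE[OF bij_betw_inv_into[OF bij]]
    by (auto simp: g_def)
  have f: "f x \<subseteq> {1..i}" if "x \<in> {I..J}" for x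
    using bij_betwE[OF bij] that by auto
  have IJ: "I \<in> {I..J}" "J \<in> {I..J}" using assms(1) by auto
  have fJ: "f J = {1..i}"
    using mono[OF g(1) IJ(2), of "{1..i}"] g[of "{1..i}"] f[OF IJ(2)] by auto
  have f_inj: "x = y" if "x \<in> {I..J}" "y \<in> {I..J}" "f x = f y" for x y
    using bij that by (meson bij_betw_imp_inj_on inj_onD)
  \<comment> \<open>The preimages of the coatoms, that is, of the complements of singletons.\<close>
  define S where "S = (\<lambda>k. g ({1..i} - {k})) ` {1..i}"
  have fin: "finite S" by (simp add: S_def)
  have "inj_on (\<lambda>k. g ({1..i} - {k})) {1..i}"
  proof (rule inj_onI)
    fix k l assume kl: "k \<in> {1..i}" "l \<in> {1..i}" "g ({1..i} - {k}) = g ({1..i} - {l})"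
    then have "{1..i} - {k} = {1..i} - {l}"
      by (metis Diff_subset g(2))
    with kl show "k = l" by blast
  qed
  then have card: "card S = i" by (simp add: S_def card_image)
  have "g ({1..i} - {k}) \<in> lower_covers J" if k: "k \<in> {1..i}" for k
  proof -
    define c where "c = g ({1..i} - {k})"
    have c: "c \<in> {I..J}" "f c = {1..i} - {k}" unfolding c_def by (rule g, blast)+
    have "c \<noteq> J" using c(2) fJ k by (metis Diff_iff singletonI)
    moreover have "x = c \<or> x = J" if x: "c \<le> x" "x \<le> J" for x
    proof -
      have xI: "x \<in> {I..J}" using x c(1) by auto
      have "{1..i} - {k} \<subseteq> f x" using mono[OF c(1) xI] x(1) unfolding c(2) by blast
      \<comment> \<open>Only \<open>k\<close> can be added to the complement of \<open>k\<close>, so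
        no set lies strictly between it and \<open>{1..i}\<close>.\<close>
      then have "f x = f c \<or> f x = f J" using f[OF xI] c(2) fJ by blast
      then show ?thesis using f_inj[OF xI c(1)] f_inj[OF xI IJ(2)] by blast
    qed
    ultimately show ?thesis using c(1) unfolding c_def[symmetric] lower_covers_def less_le by simp
  qed
  then have sub: "S \<subseteq> lower_covers J" by (auto simp: S_def)
  have "I \<le> s" if "s \<in> S" for s
    using that g(1)[OF Diff_subset] unfolding S_def by fastforce
  then have mI: "meet_below J S \<in> {I..J}"
    using IJ fin by (auto simp: le_meet_below_iff meet_below_le)
  have "k \<notin> f (meet_below J S)" if k: "k \<in> {1..i}" for k
  proof -
    have gk: "g ({1..i} - {k}) \<in> {I..J}" "f (g ({1..i} - {k})) = {1..i} - {k}"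
      by (rule g, blast)+
    have "meet_below J S \<le> g ({1..i} - {k})"
      using k by (intro meet_below_le fin) (simp add: S_def)
    then show ?thesis using mono[OF mI gk(1)] gk(2) by auto
  qed
  then have "f (meet_below J S) = {}" using f[OF mI] by blast
  then have "meet_below J S \<le> I" using mono[OF mI IJ(1)] by auto
  then have "I = meet_below J S" using mI by auto
  with sub fin card show ?thesis using that by blast
qed

lemma bij_betw_boolean_intervals:
  "bij_betw (\<lambda>(J, S). {meet_below J S..J})
     (SIGMA J:UNIV. {S. S \<subseteq> lower_covers J \<and> card S = i})
     (boolean_intervals i :: 'a::{finite, distrib_lattice} set set)"
  (is "bij_betw ?f ?A ?B")
proof (rule bij_betwI')
  fix p q assume p: "p \<in> ?A" and q: "q \<in> ?A"
  obtain J S K T where pq: "p = (J, S)" "q = (K, T)" by fastforce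
  have "S \<subseteq> lower_covers J" "T \<subseteq> lower_covers K" using p q pq by auto
  \<comment> \<open>Nonempty intervals determine their endpoints: the top gives \<open>J\<close>,
    and equal bottoms give \<open>S = T\<close> because the embedding is injective.\<close>
  then show "?f p = ?f q \<longleftrightarrow> p = q"
    using pq meet_below_mono_iff[of S J T] meet_below_mono_iff[of T J S] meet_below_le(1)[of S J]
      meet_below_le(1)[of T K]
    by auto
next
  fix p assume "p \<in> ?A"
  then obtain J S where p: "p = (J, S)" "S \<subseteq> lower_covers J" "card S = i" by auto
  have "meet_below J S \<le> J"
    by (rule meet_below_le) simp
  moreover have "order_isomorphic {meet_below J S..J} (boolean_lattice i)"
    using order_isomorphic_interval_meet_below[of S J] p by simp
  ultimately show "?f p \<in> ?B"
    unfolding boolean_intervals_def p(1) by blast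
next
  fix X :: "'a set" assume "X \<in> ?B"
  then obtain I J :: 'a where IJ: "X = {I..J}" "I \<le> J" "order_isomorphic {I..J} (boolean_lattice i)"
    unfolding boolean_intervals_def by blast
  obtain S where "S \<subseteq> lower_covers J" "card S = i" "I = meet_below J S"
    using boolean_interval_bottom[OF IJ(2,3)] by blast
  then show "\<exists>p\<in>?A. X = ?f p"
    using IJ(1) by (intro bexI[of _ "(J, S)"]) auto
qed

lemma num_boolean_intervals_eq:
  "num_boolean_intervals TYPE('a::{finite, distrib_lattice}) i =
     (\<Sum>J\<in>(UNIV :: 'a set). card (lower_covers J) choose i)"
proof -
  have "num_boolean_intervals TYPE('a) i =
      card (SIGMA J:(UNIV :: 'a set). {S. S \<subseteq> lower_covers J \<and> card S = i})"
    unfolding num_boolean_intervals_def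
    by (rule bij_betw_same_card[OF bij_betw_boolean_intervals, symmetric])
  then show ?thesis
    by (simp add: n_subsets)
qed

text \<open>By finiteness, if \<open>J\<close> is not least, the elements strictly below it have a
  maximal one, which is a lower cover.\<close>

lemma lower_covers_eq_empty_iff:
  fixes J :: "'a::{finite, lattice}"
  shows "lower_covers J = {} \<longleftrightarrow> J = Inf_fin UNIV"
proof
  assume empty: "lower_covers J = {}"
  show "J = Inf_fin UNIV"
  proof (rule ccontr)
    assume "J \<noteq> Inf_fin UNIV"
    then have "Inf_fin UNIV \<in> {x. x < J}"
      by (auto simp: less_le intro: Inf_fin.coboundedI)
    then obtain c where c: "c < J" "\<And>x. x < J \<Longrightarrow> c \<le> x \<Longrightarrow> c = x"
      using finite_has_maximal[of "{x. x < J}"] by auto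
    then have "c \<in> lower_covers J"
      by (auto simp: lower_covers_def less_le)
    with empty show False by simp
  qed
next
  assume "J = Inf_fin UNIV"
  then have "\<not> c < J" for c
    using Inf_fin.coboundedI[of UNIV c] by auto
  then show "lower_covers J = {}"
    by (auto simp: lower_covers_def)
qed

text \<open>Terms with \<open>i > n\<close> vanish, so the series is the binomial expansion of
  \<open>(1 - 1) ^ n\<close>, which is 1 for \<open>n = 0\<close>.\<close>

lemma alternating_binomial_sums:
  "(\<lambda>i. (-1) ^ i * int (n choose i)) sums (if n = 0 then 1 else 0)"
proof -
  have "(\<lambda>i. (-1) ^ i * int (n choose i)) sums (\<Sum>i\<le>n. (-1) ^ i * int (n choose i))"
    by (rule sums_finite) (auto simp: binomial_eq_0)
  moreover have "(\<Sum>i\<le>n. (-1) ^ i * int (n choose i)) = (if n = 0 then 1 else 0)"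
    using choose_alternating_sum[of n, where 'a = int] by auto
  ultimately show ?thesis by simp
qed

theorem corollary2p3:
  shows "(\<lambda>i. (-1) ^ i * int (num_boolean_intervals TYPE('a::{finite, distrib_lattice}) i)) sums 1"
proof -
  have "(\<lambda>i. \<Sum>J\<in>(UNIV :: 'a set). (-1) ^ i * int (card (lower_covers J) choose i)) sums
      (\<Sum>J\<in>(UNIV :: 'a set). if card (lower_covers J) = 0 then 1 else 0)"
    by (intro sums_sum alternating_binomial_sums)
  \<comment> \<open>Exactly one \<open>J\<close>, the least element, has no lower covers.\<close>
  moreover have "(\<Sum>J\<in>(UNIV :: 'a set). if card (lower_covers J) = 0 then 1 else 0) = (1 :: int)"
    by (simp add: lower_covers_eq_empty_iff)
  ultimately show ?thesis
    by (simp add: num_boolean_intervals_eq sum_distrib_left)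
qed

end
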